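(* For every complex number $q$ with $|q|<1$, $$\sum_{n\geq 0} G(n) q^n=\frac{q^3}{(1+q)(1-q^3)}\,\frac{(q^2;q^2)_\infty^2}{(q;q^2)_\infty^2}-\frac{q^2(1-q)(-1+q^3+q^4+q^5)}{(1-q^3)^2(1-q^5)},$$ where $G(n)$ are the power series coefficients defined by $$\sum_{n\geq 0} G(n) q^n=\sum_{k,n\geq 0} \frac{(q^{2n+2};q^2)_k}{(q^{2n+1};q^2)_k}\,q^{2k+5n+2}.$$
   Context: Notation: $q$ is a complex number with $|q|<1$; $(a;q)_0=1$, $(a;q)_n=\prod_{j=0}^{n-1}(1-aq^j)$, $(a;q)_\infty=\prod_{j=0}^\infty(1-aq^j)$ (and the same with $q$ replaced by $q^2$). The double sum runs over all nonnegative integers $k,n$. The integers $G(N)$, $N\ge 0$, are the coefficients of the power series in $q$ given by this double sum. *)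

theory Defs
  imports "HOL-Complex_Analysis.Complex_Analysis"
begin

definition qpoch :: "complex \<Rightarrow> complex \<Rightarrow> nat \<Rightarrow> complex" where
  "qpoch a q n = (\<Prod>j<n. 1 - a * q ^ j)"

definition qpoch_inf :: "complex \<Rightarrow> complex \<Rightarrow> complex" where
  "qpoch_inf a q = (\<Prod>j. 1 - a * q ^ j)"

definition G_term :: "complex \<Rightarrow> nat \<Rightarrow> nat \<Rightarrow> complex" where
  "G_term q k n =
     qpoch (q ^ (2 * n + 2)) (q ^ 2) k / qpoch (q ^ (2 * n + 1)) (q ^ 2) k * q ^ (2 * k + 5 * n + 2)"

definition G_series :: "complex \<Rightarrow> complex" where
  "G_series q = (\<Sum>\<^sub>\<infinity>(k, n)\<in>UNIV. G_term q k n)"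

(* The coefficients of the power series in q represented by the double sum, that is, its Taylor
   coefficients at q = 0. They are complex by type; that they are integers is a theorem. *)
definition G :: "nat \<Rightarrow> complex" where
  "G N = fps_nth (fps_expansion G_series 0) N"

end

theory Submission
  imports Defs
begin

text \<open>
  Put \<open>Q = q\<^sup>2\<close>, \<open>a\<^sub>n = (Q;Q)\<^sub>n / (q;Q)\<^sub>n\<close> and \<open>P = (Q;Q)\<^sub>\<infinity> / (q;Q)\<^sub>\<infinity>\<close>, the limit of \<open>a\<^sub>n\<close>.  The
  summand is \<open>(a\<^sub>n\<^sub>+\<^sub>k / a\<^sub>n) q\<^bsup>2k+5n+2\<^esup>\<close>, and for fixed \<open>n\<close> the sum over \<open>k\<close> telescopes: the
  differences of \<open>((a)\<^sub>k / (b)\<^sub>k) (p - b p\<^sup>k)\<close> are \<open>(b - a p) ((a)\<^sub>k / (b)\<^sub>k) p\<^sup>k\<close>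
  (\<open>qpoch_quotient_telescope\<close>).  What remains is a single sum over \<open>n\<close> of
  \<open>(q\<^sup>3 P (1 / a\<^sub>n) q\<^bsup>3n\<^esup> - q\<^sup>3 q\<^bsup>3n\<^esup> + q\<^sup>2 q\<^bsup>5n\<^esup>) / (1 - q\<^sup>3)\<close>.  Two of its three parts are geometric
  series and give the rational term.  The third is the q-binomial series in base \<open>Q\<close> with
  parameter \<open>q\<close> and argument \<open>q\<^sup>3\<close>; its value \<open>(q\<^sup>4;Q)\<^sub>\<infinity> / (q\<^sup>3;Q)\<^sub>\<infinity>\<close> is \<open>P / (1 + q)\<close>, because each
  product is \<open>(Q;Q)\<^sub>\<infinity>\<close> or \<open>(q;Q)\<^sub>\<infinity>\<close> without its first factor.  This second \<open>P\<close> is the reason for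
  the squares in the closed form.

  The analytic part rests on one estimate: on a disc of radius \<open>r < 1\<close> the quotients of
  q-shifted factorials are bounded by a constant depending only on \<open>r\<close>
  (\<open>norm_qpoch_quotient_le\<close>), so the summand is dominated by a multiple of \<open>r\<^sup>k r\<^sup>n\<close>.  This gives
  absolute summability, which permits the exchange of the two summations, and locally uniform
  convergence, so that the sum is holomorphic in the unit disc and equals its Taylor series.  The
  Taylor coefficients are limits of those of finite partial sums.  The latter are integers, since
  a formal power series with integer coefficients and constant term 1 has an inverse with integer
  coefficients, and the integers are closed in the complex plane.
\<close>

section \<open>Finite and infinite q-shifted factorials\<close>

lemma norm_power_less_1:
  fixes q :: complex
  assumes "norm q < 1" "m > 0"
  shows "norm (q ^ m) < 1"
  using assms by (simp add: norm_power power_less_one_iff)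

lemma one_minus_power_nonzero:
  fixes q :: complex
  assumes "norm q < 1" "m > 0"
  shows "1 - q ^ m \<noteq> 0"
  using norm_power_less_1[OF assms] by (auto dest: sym)

lemma qpoch_0 [simp]: "qpoch a q 0 = 1"
  by (simp add: qpoch_def)

lemma qpoch_Suc: "qpoch a q (Suc n) = qpoch a q n * (1 - a * q ^ n)"
  by (simp add: qpoch_def)

lemma qpoch_add: "qpoch a q (m + n) = qpoch a q m * qpoch (a * q ^ m) q n"
  by (induction n) (simp_all add: qpoch_Suc power_add mult_ac)

lemma qpoch_factor_nonzero:
  assumes "norm a < 1" "norm q < 1"
  shows "(1 :: complex) - a * q ^ j \<noteq> 0"
proof
  assume "1 - a * q ^ j = 0"
  hence "norm a * norm q ^ j = 1"
    by (metis norm_mult norm_one norm_power right_minus_eq)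
  moreover have "norm a * norm q ^ j \<le> norm a * 1"
    using assms by (intro mult_left_mono power_le_one) auto
  ultimately show False using assms by simp
qed

lemma qpoch_nonzero: "norm a < 1 \<Longrightarrow> norm q < 1 \<Longrightarrow> qpoch a q n \<noteq> 0"
  using qpoch_factor_nonzero[of a q] by (simp add: qpoch_def)

lemma convergent_prod_qpoch:
  assumes "norm q < 1"
  shows "convergent_prod (\<lambda>j. (1 :: complex) - a * q ^ j)"
proof -
  have "summable (\<lambda>j. norm a * norm q ^ j)"
    using assms by (intro summable_mult summable_geometric) simp
  hence "summable (\<lambda>j. norm ((1 - a * q ^ j) - 1))"
    by (simp add: norm_mult norm_power)
  thus ?thesis
    by (intro abs_convergent_prod_imp_convergent_prod summable_imp_abs_convergent_prod)
qed

lemma qpoch_LIMSEQ: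
  assumes "norm q < 1"
  shows "qpoch a q \<longlonglongrightarrow> qpoch_inf a q"
proof -
  have "(\<lambda>n. \<Prod>j<n. 1 - a * q ^ j) \<longlonglongrightarrow> qpoch_inf a q"
    using convergent_prod_LIMSEQ[OF convergent_prod_qpoch[OF assms, of a]]
    by (simp add: qpoch_inf_def LIMSEQ_lessThan_iff_atMost)
  thus ?thesis by (simp add: qpoch_def[abs_def])
qed

lemma qpoch_inf_nonzero: "norm a < 1 \<Longrightarrow> norm q < 1 \<Longrightarrow> qpoch_inf a q \<noteq> 0"
  unfolding qpoch_inf_def
  by (rule prodinf_nonzero[OF convergent_prod_qpoch qpoch_factor_nonzero])

lemma qpoch_inf_split:
  assumes "norm q < 1"
  shows "qpoch_inf a q = qpoch a q m * qpoch_inf (a * q ^ m) q"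
proof (rule LIMSEQ_unique)
  show "(\<lambda>n. qpoch a q (n + m)) \<longlonglongrightarrow> qpoch_inf a q"
    by (rule LIMSEQ_ignore_initial_segment[OF qpoch_LIMSEQ[OF assms]])
  show "(\<lambda>n. qpoch a q (n + m)) \<longlonglongrightarrow> qpoch a q m * qpoch_inf (a * q ^ m) q"
    using tendsto_mult_left[OF qpoch_LIMSEQ[OF assms, of "a * q ^ m"], of "qpoch a q m"]
    by (simp add: add.commute[of _ m] qpoch_add)
qed

text \<open>
  The bound is uniform in \<open>k\<close> and in the parameters, which is what turns it into a majorant for the
  double sum.  The factors \<open>(1 + x) / (1 - x)\<close> with \<open>x = r\<^bsup>j+1\<^esup>\<close> are close to 1 at a geometric rate, so
  after passing to exponentials the exponents add up to a geometric series.
\<close>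

lemma norm_qpoch_quotient_le:
  assumes "norm a \<le> r" "norm b \<le> r" "norm q \<le> r" "r < 1"
  shows "norm (qpoch a q k / qpoch b q k) \<le> exp (2 / (1 - r) ^ 2)"
proof -
  have r0: "0 \<le> r" using assms(1) norm_ge_zero order_trans by blast
  have small: "norm (c * q ^ j) \<le> r * r ^ j" if "norm c \<le> r" for c j
    using that assms r0 by (auto simp: norm_mult norm_power intro!: mult_mono power_mono)
  have factor: "norm ((1 - a * q ^ j) / (1 - b * q ^ j)) \<le> exp (2 / (1 - r) * r ^ j)" for j
  proof -
    define x where "x = r * r ^ j"
    have x: "0 \<le> x" "x \<le> r" "x \<le> r ^ j"
      using r0 assms(4) by (auto simp: x_def mult_left_le power_le_one mult_left_le_one_le)
    have "norm (1 - a * q ^ j) \<le> 1 + x"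
      using norm_triangle_ineq4[of 1 "a * q ^ j"] small[OF assms(1), of j] by (simp add: x_def)
    moreover have "1 - x \<le> norm (1 - b * q ^ j)"
      using norm_triangle_ineq2[of 1 "b * q ^ j"] small[OF assms(2), of j] by (simp add: x_def)
    ultimately have "norm ((1 - a * q ^ j) / (1 - b * q ^ j)) \<le> (1 + x) / (1 - x)"
      unfolding norm_divide using x assms(4) by (intro frac_le) auto
    also have "\<dots> = 1 + 2 * x / (1 - x)"
      using x assms(4) by (simp add: field_simps)
    also have "\<dots> \<le> 1 + 2 * r ^ j / (1 - r)"
      using x assms(4) r0 by (intro add_left_mono frac_le) auto
    also have "\<dots> \<le> exp (2 / (1 - r) * r ^ j)"
      using exp_ge_add_one_self[of "2 * r ^ j / (1 - r)"] by simp
    finally show ?thesis .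
  qed
  have "norm (qpoch a q k / qpoch b q k) = (\<Prod>j<k. norm ((1 - a * q ^ j) / (1 - b * q ^ j)))"
    by (simp add: qpoch_def prod_dividef prod_norm)
  also have "\<dots> \<le> (\<Prod>j<k. exp (2 / (1 - r) * r ^ j))"
    by (intro prod_mono) (use factor in auto)
  also have "\<dots> = exp (2 / (1 - r) * (\<Sum>j<k. r ^ j))"
    by (simp add: exp_sum sum_distrib_left)
  also have "\<dots> \<le> exp (2 / (1 - r) * (1 / (1 - r)))"
  proof -
    have "(\<Sum>j<k. r ^ j) \<le> 1 / (1 - r)"
      using sum_le_suminf[of "\<lambda>j. r ^ j" "{..<k}"] r0 assms(4)
      by (simp add: suminf_geometric summable_geometric)
    thus ?thesis using assms(4) by (intro iffD2[OF exp_le_cancel_iff] mult_left_mono) auto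
  qed
  finally show ?thesis by (simp add: power2_eq_square)
qed

section \<open>The q-binomial theorem\<close>

text \<open>
  The coefficients satisfy \<open>c\<^sub>n\<^sub>+\<^sub>1 (1 - q\<^bsup>n+1\<^esup>) = c\<^sub>n (1 - a q\<^sup>n)\<close>, which says that the sum \<open>F\<close> obeys
  \<open>(1 - z) F z = (1 - a z) F (z q)\<close>.  Iterating pushes the argument to \<open>z q\<^sup>n\<close> and collects the two
  finite products; continuity of \<open>F\<close> at 0, where its value is 1, yields the infinite ones.
\<close>

lemma q_binomial:
  assumes q: "norm q < 1" and z: "norm z < 1"
  shows "(\<lambda>n. qpoch a q n / qpoch q q n * z ^ n) sums (qpoch_inf (a * z) q / qpoch_inf z q)"
proof -
  define c where "c = (\<lambda>n. qpoch a q n / qpoch q q n)"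
  define F where "F = (\<lambda>w. \<Sum>n. c n * w ^ n)"
  \<comment> \<open>The coefficients converge, hence are bounded, and the series converges like a geometric one.\<close>
  have "c \<longlonglongrightarrow> qpoch_inf a q / qpoch_inf q q"
    unfolding c_def by (intro tendsto_divide qpoch_LIMSEQ qpoch_inf_nonzero q)
  hence "Bseq c"
    by (intro convergent_imp_Bseq) (auto simp: convergent_def)
  then obtain B where B: "\<And>n. norm (c n) \<le> B"
    by (auto simp: Bseq_def)
  have summ: "summable (\<lambda>n. c n * w ^ n)" if w: "norm w < 1" for w
  proof (rule summable_comparison_test')
    show "summable (\<lambda>n. B * norm w ^ n)"
      using w by (intro summable_mult summable_geometric) simp
    show "norm (c n * w ^ n) \<le> B * norm w ^ n" for n
      unfolding norm_mult norm_power using B by (intro mult_right_mono) auto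
  qed
  have recur: "(1 - w) * F w = (1 - a * w) * F (w * q)" if w: "norm w < 1" for w
  proof -
    have wq: "norm (w * q) < 1"
      using mult_strict_mono'[OF w q] by (simp add: norm_mult)
    have coeff: "c (Suc n) * (1 - q ^ Suc n) = c n * (1 - a * q ^ n)" for n
      using qpoch_nonzero[OF q q] qpoch_factor_nonzero[OF q q, of n]
      by (simp add: c_def qpoch_Suc field_simps)
    have head: "F v = 1 + (\<Sum>n. c (Suc n) * v ^ Suc n)" if "norm v < 1" for v
      unfolding F_def using suminf_split_head[OF summ[OF that]] by (simp add: c_def)
    have s: "summable (\<lambda>n. c (Suc n) * v ^ Suc n)" if "norm v < 1" for v
      using summ[OF that] by (subst summable_Suc_iff)
    have "F w - F (w * q) = (\<Sum>n. c (Suc n) * w ^ Suc n - c (Suc n) * (w * q) ^ Suc n)"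
      using head[OF w] head[OF wq] suminf_diff[OF s[OF w] s[OF wq]] by simp
    also have "\<dots> = (\<Sum>n. w * (c n * w ^ n) - a * w * (c n * (w * q) ^ n))"
    proof (rule suminf_cong)
      fix n
      have "c (Suc n) * w ^ Suc n - c (Suc n) * (w * q) ^ Suc n
              = w ^ Suc n * (c (Suc n) * (1 - q ^ Suc n))"
        by (simp add: algebra_simps power_mult_distrib)
      also have "\<dots> = w * (c n * w ^ n) - a * w * (c n * (w * q) ^ n)"
        unfolding coeff by (simp add: algebra_simps power_mult_distrib)
      finally show "c (Suc n) * w ^ Suc n - c (Suc n) * (w * q) ^ Suc n
              = w * (c n * w ^ n) - a * w * (c n * (w * q) ^ n)" .
    qed
    also have "\<dots> = w * F w - a * w * F (w * q)"
      unfolding F_def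
      by (subst suminf_diff[symmetric]) (simp_all add: summ w wq summable_mult suminf_mult)
    finally show ?thesis by (simp add: algebra_simps)
  qed
  have zq: "norm (z * q ^ n) < 1" for n
  proof -
    have "norm z * norm q ^ n \<le> norm z * 1"
      using q by (intro mult_left_mono power_le_one) auto
    thus ?thesis using z by (simp add: norm_mult norm_power)
  qed
  have iterate: "qpoch z q n * F z = qpoch (a * z) q n * F (z * q ^ n)" for n
  proof (induction n)
    case (Suc n)
    have "qpoch z q (Suc n) * F z = (1 - z * q ^ n) * (qpoch z q n * F z)"
      by (simp add: qpoch_Suc mult_ac)
    also have "\<dots> = qpoch (a * z) q n * ((1 - z * q ^ n) * F (z * q ^ n))"
      unfolding Suc by (simp only: mult_ac)
    also have "\<dots> = qpoch (a * z) q (Suc n) * F (z * q ^ Suc n)"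
      unfolding recur[OF zq] by (simp add: qpoch_Suc mult_ac)
    finally show ?case .
  qed simp
  have "(F \<longlongrightarrow> F 0) (at 0)"
  proof -
    have "(F \<longlongrightarrow> c 0) (at 0)"
      using summ by (intro powser_limit_0[of 1]) (auto simp: F_def summable_sums)
    thus ?thesis by (simp add: F_def)
  qed
  hence "isCont F 0" by (simp add: isCont_def)
  moreover have "(\<lambda>n. z * q ^ n) \<longlonglongrightarrow> 0"
    using tendsto_mult_left[OF LIMSEQ_power_zero[OF q], of z] by simp
  ultimately have "(\<lambda>n. F (z * q ^ n)) \<longlonglongrightarrow> F 0"
    by (rule isCont_tendsto_compose)
  moreover have "F 0 = c 0" by (simp add: F_def)
  ultimately have "(\<lambda>n. qpoch (a * z) q n * F (z * q ^ n)) \<longlonglongrightarrow> qpoch_inf (a * z) q * 1"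
    by (intro tendsto_mult qpoch_LIMSEQ q) (simp add: c_def)
  moreover have "(\<lambda>n. qpoch (a * z) q n * F (z * q ^ n)) \<longlonglongrightarrow> qpoch_inf z q * F z"
    unfolding iterate[symmetric] by (intro tendsto_mult_right qpoch_LIMSEQ q)
  ultimately have "qpoch_inf z q * F z = qpoch_inf (a * z) q"
    using LIMSEQ_unique by fastforce
  hence "F z = qpoch_inf (a * z) q / qpoch_inf z q"
    using qpoch_inf_nonzero[OF z q] by (simp add: field_simps)
  thus ?thesis
    using summable_sums[OF summ[OF z]] by (simp add: F_def c_def)
qed

section \<open>Evaluating the double sum\<close>

text \<open>
  The usual telescoping quotient is \<open>(a;p)\<^sub>k / (b;p)\<^sub>k\<^sub>-\<^sub>1\<close>, up to a constant.  Writing the missing factor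
  of the denominator as \<open>p - b p\<^sup>k\<close> clears the index \<open>k - 1\<close> and a division by \<open>p\<close>, so
  that the identity also holds at \<open>k = 0\<close> and \<open>p = 0\<close>.
\<close>

lemma qpoch_quotient_telescope:
  assumes p: "norm p < 1" and b: "norm b < 1"
  shows "(\<lambda>k. (b - a * p) * (qpoch a p k / qpoch b p k * p ^ k)) sums
           (p * (qpoch_inf a p / qpoch_inf b p) - (p - b))"
proof -
  define e where "e = (\<lambda>k. qpoch a p k / qpoch b p k * (p - b * p ^ k))"
  have "(\<lambda>k. b * p ^ k) \<longlonglongrightarrow> 0"
    using tendsto_mult_left[OF LIMSEQ_power_zero[OF p], of b] by simp
  hence "e \<longlonglongrightarrow> qpoch_inf a p / qpoch_inf b p * (p - 0)"
    unfolding e_def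
    by (intro tendsto_mult tendsto_divide tendsto_diff tendsto_const
          qpoch_LIMSEQ qpoch_inf_nonzero p b)
  from telescope_sums[OF this]
  have "(\<lambda>k. e (Suc k) - e k) sums (p * (qpoch_inf a p / qpoch_inf b p) - (p - b))"
    by (simp add: e_def mult.commute)
  moreover have "e (Suc k) - e k = (b - a * p) * (qpoch a p k / qpoch b p k * p ^ k)" for k
  proof -
    have "e (Suc k) = qpoch a p k / qpoch b p k * (p * (1 - a * p ^ k))"
    proof -
      have nz: "1 - b * p ^ k \<noteq> 0" by (rule qpoch_factor_nonzero[OF b p])
      have "p - b * p ^ Suc k = p * (1 - b * p ^ k)" by (simp add: algebra_simps)
      thus ?thesis unfolding e_def qpoch_Suc using nz by simp
    qed
    hence "e (Suc k) - e k
        = qpoch a p k / qpoch b p k * (p * (1 - a * p ^ k) - (p - b * p ^ k))"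
      by (simp only: e_def right_diff_distrib)
    also have "p * (1 - a * p ^ k) - (p - b * p ^ k) = (b - a * p) * p ^ k"
      by (simp add: algebra_simps)
    finally show ?thesis by simp
  qed
  ultimately show ?thesis by simp
qed

lemma norm_G_term_le:
  assumes "norm q \<le> r" "r < 1"
  shows "norm (G_term q k n) \<le> exp (2 / (1 - r) ^ 2) * (r ^ k * r ^ n)"
proof -
  have r0: "0 \<le> r" using assms(1) norm_ge_zero order_trans by blast
  have pow: "norm (q ^ m) \<le> r ^ l" if "l \<le> m" for l m
  proof -
    have "norm q ^ m \<le> r ^ m" using assms by (intro power_mono) auto
    also have "\<dots> \<le> r ^ l" using r0 assms that by (intro power_decreasing) auto
    finally show ?thesis by (simp add: norm_power)
  qed
  have "norm (qpoch (q ^ (2 * n + 2)) (q ^ 2) k / qpoch (q ^ (2 * n + 1)) (q ^ 2) k)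
          \<le> exp (2 / (1 - r) ^ 2)"
    by (rule norm_qpoch_quotient_le) (use pow[of 1] assms in \<open>simp_all del: power_Suc add_2_eq_Suc'\<close>)
  moreover have "norm (q ^ (2 * k + 5 * n + 2)) \<le> r ^ k * r ^ n"
    using pow[of "k + n" "2 * k + 5 * n + 2"] by (simp add: power_add)
  ultimately show ?thesis
    unfolding G_term_def norm_mult[of "_ / _"] by (intro mult_mono) auto
qed

lemma summable_on_geometric_pairs:
  fixes r C :: real
  assumes "0 \<le> r" "r < 1"
  shows "(\<lambda>(k, n). C * (r ^ k * r ^ n)) summable_on (UNIV :: (nat \<times> nat) set)"
proof -
  have g: "((\<lambda>n. r ^ n) has_sum (1 / (1 - r))) UNIV"
    using assms by (intro sums_nonneg_imp_has_sum geometric_sums) auto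
  have "(\<lambda>(k, n). r ^ k * r ^ n) summable_on (UNIV \<times> (UNIV :: nat set))"
  proof (rule summable_on_SigmaI)
    show "((\<lambda>n. case (k, n) of (k, n) \<Rightarrow> r ^ k * r ^ n) has_sum r ^ k * (1 / (1 - r))) UNIV" for k
      using has_sum_cmult_right[OF g] by simp
    show "(\<lambda>k. r ^ k * (1 / (1 - r))) summable_on UNIV"
      using has_sum_imp_summable[OF g] by (rule summable_on_cmult_left)
  qed (use assms in auto)
  from summable_on_cmult_right[OF this, of C] show ?thesis
    by (simp add: case_prod_unfold)
qed

lemma G_term_abs_summable:
  assumes "norm q < 1"
  shows "(\<lambda>(k, n). norm (G_term q k n)) summable_on UNIV"
proof -
  have "(\<lambda>x. norm (case x of (k, n) \<Rightarrow> G_term q k n)) summable_on UNIV"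
    using norm_G_term_le[OF order_refl assms]
    by (intro Infinite_Sum.abs_summable_on_comparison_test'[OF
          summable_on_geometric_pairs[OF norm_ge_zero assms, of "exp (2 / (1 - norm q) ^ 2)"]])
       auto
  thus ?thesis by (simp add: case_prod_unfold)
qed

text \<open>
  Telescoping applies with base \<open>q\<^sup>2\<close> and parameters \<open>q\<^bsup>2n+2\<^esup>\<close> and \<open>q\<^bsup>2n+1\<^esup>\<close>; the prefactor
  \<open>b - a p\<close> becomes \<open>q\<^bsup>2n+1\<^esup> (1 - q\<^sup>3)\<close>, and it is to divide by it that \<open>q \<noteq> 0\<close> is assumed.
\<close>

lemma sums_G_term_inner:
  assumes q: "norm q < 1" and q0: "q \<noteq> 0"
  shows "(\<lambda>k. G_term q k n) sums
     (q ^ 3 / (1 - q ^ 3) * (qpoch_inf (q ^ 2) (q ^ 2) / qpoch_inf q (q ^ 2))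
        * (qpoch q (q ^ 2) n / qpoch (q ^ 2) (q ^ 2) n * (q ^ 3) ^ n)
      - q ^ 3 / (1 - q ^ 3) * (q ^ 3) ^ n + q ^ 2 / (1 - q ^ 3) * (q ^ 5) ^ n)"
proof -
  note less1 = norm_power_less_1[OF q]
  define x R where "x = q ^ (2 * n)"
    and "R = qpoch_inf (q ^ (2 * n + 2)) (q ^ 2) / qpoch_inf (q ^ (2 * n + 1)) (q ^ 2)"
  have x0: "x \<noteq> 0" using q0 by (simp add: x_def)
  have q3: "1 - q ^ 3 \<noteq> 0" by (rule one_minus_power_nonzero[OF q]) simp
  have "(\<lambda>k. (q ^ (2 * n + 1) - q ^ (2 * n + 2) * q ^ 2) *
          (qpoch (q ^ (2 * n + 2)) (q ^ 2) k / qpoch (q ^ (2 * n + 1)) (q ^ 2) k * (q ^ 2) ^ k))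
        sums (q ^ 2 * R - (q ^ 2 - q ^ (2 * n + 1)))"
    unfolding R_def by (rule qpoch_quotient_telescope; rule less1) simp_all
  from sums_mult[OF this, of "q ^ (5 * n + 2) / (x * q * (1 - q ^ 3))"]
  have "(\<lambda>k. G_term q k n) sums
          (q ^ (5 * n + 2) / (x * q * (1 - q ^ 3)) * (q ^ 2 * R - (q ^ 2 - q ^ (2 * n + 1))))"
  proof (rule back_subst[of "\<lambda>f. f sums _"], intro ext)
    fix k
    have "q ^ (2 * n + 1) - q ^ (2 * n + 2) * q ^ 2 = x * q * (1 - q ^ 3)"
      by (simp add: x_def power_add algebra_simps power2_eq_square power3_eq_cube)
    thus "q ^ (5 * n + 2) / (x * q * (1 - q ^ 3)) * ((q ^ (2 * n + 1) - q ^ (2 * n + 2) * q ^ 2) *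
          (qpoch (q ^ (2 * n + 2)) (q ^ 2) k / qpoch (q ^ (2 * n + 1)) (q ^ 2) k * (q ^ 2) ^ k))
        = G_term q k n"
      using x0 q0 q3
      by (simp add: G_term_def power_add power_mult[of q 2 k, symmetric] mult_ac)
  qed
  also have "q ^ (5 * n + 2) / (x * q * (1 - q ^ 3)) * (q ^ 2 * R - (q ^ 2 - q ^ (2 * n + 1)))
      = q ^ 3 / (1 - q ^ 3) * (R * (q ^ 3) ^ n)
        - q ^ 3 / (1 - q ^ 3) * (q ^ 3) ^ n + q ^ 2 / (1 - q ^ 3) * (q ^ 5) ^ n"
  proof -
    have e1: "q ^ (5 * n + 2) = x * q * (q * (q ^ 3) ^ n)"
      unfolding x_def power_mult[symmetric] by (simp add: power_add[symmetric])
    have e2: "q ^ 2 * R - (q ^ 2 - q ^ (2 * n + 1)) = q * (q * R - q + x)"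
      by (simp add: x_def power2_eq_square algebra_simps)
    have e3: "(q ^ 5) ^ n = x * (q ^ 3) ^ n"
      by (simp add: x_def power_mult[symmetric] power_add[symmetric])
    have "q ^ (5 * n + 2) / (x * q * (1 - q ^ 3)) * (q ^ 2 * R - (q ^ 2 - q ^ (2 * n + 1)))
        = q * (q ^ 3) ^ n * (q * (q * R - q + x)) / (1 - q ^ 3)"
      unfolding e1 e2 using x0 q0 by simp
    also have "\<dots> = q ^ 3 / (1 - q ^ 3) * (R * (q ^ 3) ^ n)
        - q ^ 3 / (1 - q ^ 3) * (q ^ 3) ^ n + q ^ 2 / (1 - q ^ 3) * (q ^ 5) ^ n"
    proof -
      have "q * (q ^ 3) ^ n * (q * (q * R - q + x))
          = q ^ 3 * (R * (q ^ 3) ^ n) - q ^ 3 * (q ^ 3) ^ n + q ^ 2 * (x * (q ^ 3) ^ n)"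
        by (simp only: power2_eq_square power3_eq_cube algebra_simps)
      thus ?thesis unfolding e3 by (simp add: add_divide_distrib diff_divide_distrib)
    qed
    finally show ?thesis .
  qed
  also have "R = qpoch_inf (q ^ 2) (q ^ 2) / qpoch_inf q (q ^ 2)
                   * (qpoch q (q ^ 2) n / qpoch (q ^ 2) (q ^ 2) n)"
  proof -
    have s: "qpoch_inf (q ^ m) (q ^ 2)
             = qpoch (q ^ m) (q ^ 2) n * qpoch_inf (q ^ (2 * n + m)) (q ^ 2)" for m
      using qpoch_inf_split[of "q ^ 2" "q ^ m" n] less1[of 2]
      by (simp add: power_add mult.commute flip: power_mult)
    have nz: "qpoch (q ^ 1) (q ^ 2) n \<noteq> 0" "qpoch (q ^ 2) (q ^ 2) n \<noteq> 0"
      by (rule qpoch_nonzero; use less1 q in simp)+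
    show ?thesis
      using s[of 1] s[of 2] nz by (simp add: R_def)
  qed
  finally show ?thesis by (simp add: mult.assoc)
qed

text \<open>
  The q-binomial theorem with \<open>a = q\<close> and \<open>z = q\<^sup>3\<close>.  The factor \<open>1 + q\<close> is the quotient of the two
  first factors \<open>1 - q\<^sup>2\<close> and \<open>1 - q\<close> that are split off the infinite products.
\<close>

lemma sums_qpoch_cubes:
  assumes q: "norm q < 1"
  shows "(\<lambda>n. qpoch q (q ^ 2) n / qpoch (q ^ 2) (q ^ 2) n * (q ^ 3) ^ n) sums
           (qpoch_inf (q ^ 2) (q ^ 2) / qpoch_inf q (q ^ 2) / (1 + q))"
proof -
  note less1 = norm_power_less_1[OF q]
  have "(\<lambda>n. qpoch q (q ^ 2) n / qpoch (q ^ 2) (q ^ 2) n * (q ^ 3) ^ n) sums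
          (qpoch_inf (q * q ^ 3) (q ^ 2) / qpoch_inf (q ^ 3) (q ^ 2))"
    by (rule q_binomial) (use less1 in auto)
  moreover have "qpoch_inf (q ^ m) (q ^ 2) = (1 - q ^ m) * qpoch_inf (q ^ (m + 2)) (q ^ 2)" for m
    using qpoch_inf_split[of "q ^ 2" "q ^ m" 1] less1[of 2]
    by (simp add: qpoch_Suc power_add del: add_2_eq_Suc')
  note this[of 1] this[of 2]
  moreover have "1 - q \<noteq> 0" "1 - q ^ 2 \<noteq> 0"
    using one_minus_power_nonzero[OF q, of 1] one_minus_power_nonzero[OF q, of 2] by auto
  moreover have factor: "1 - q ^ 2 = (1 - q) * (1 + q)"
    by (simp add: power2_eq_square algebra_simps)
  moreover have "1 + q \<noteq> 0"
    using factor one_minus_power_nonzero[OF q, of 2] by (metis mult_zero_right zero_less_numeral)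
  ultimately show ?thesis
    by (simp add: power_numeral_reduce mult.assoc)
qed

lemma G_series_closed_form:
  assumes q: "norm q < 1"
  shows "G_series q =
    q ^ 3 / ((1 + q) * (1 - q ^ 3)) * ((qpoch_inf (q ^ 2) (q ^ 2)) ^ 2 / (qpoch_inf q (q ^ 2)) ^ 2)
    - q ^ 2 * (1 - q) * (- 1 + q ^ 3 + q ^ 4 + q ^ 5) / ((1 - q ^ 3) ^ 2 * (1 - q ^ 5))"
proof (cases "q = 0")
  case True
  thus ?thesis by (simp add: G_series_def G_term_def case_prod_unfold)
next
  case False
  define P where "P = qpoch_inf (q ^ 2) (q ^ 2) / qpoch_inf q (q ^ 2)"
  define h where "h = (\<lambda>n. q ^ 3 / (1 - q ^ 3) * P
        * (qpoch q (q ^ 2) n / qpoch (q ^ 2) (q ^ 2) n * (q ^ 3) ^ n)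
      - q ^ 3 / (1 - q ^ 3) * (q ^ 3) ^ n + q ^ 2 / (1 - q ^ 3) * (q ^ 5) ^ n)"
  have "(\<lambda>x. norm (case x of (k, n) \<Rightarrow> G_term q k n)) summable_on UNIV"
    using G_term_abs_summable[OF q] by (simp add: case_prod_unfold)
  hence summ: "(\<lambda>(k, n). G_term q k n) summable_on UNIV \<times> UNIV"
    using abs_summable_summable by force
  hence summ': "(\<lambda>(n, k). G_term q k n) summable_on UNIV \<times> UNIV"
    by (subst (asm) summable_on_swap) simp
  have inner: "(\<Sum>\<^sub>\<infinity>k. G_term q k n) = h n" for n
  proof -
    have "(\<lambda>k. G_term q k n) summable_on UNIV"
      using summable_on_SigmaD1[OF summ', of n] by simp
    hence "(\<lambda>k. G_term q k n) sums (\<Sum>\<^sub>\<infinity>k. G_term q k n)"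
      by (intro has_sum_imp_sums has_sum_infsum)
    thus ?thesis
      using sums_G_term_inner[OF q False, of n] sums_unique2 unfolding h_def P_def by blast
  qed
  have "G_series q = (\<Sum>\<^sub>\<infinity>n. \<Sum>\<^sub>\<infinity>k. G_term q k n)"
    unfolding G_series_def
    using infsum_swap_banach[OF summ] infsum_Sigma'_banach[OF summ] by simp
  hence G: "G_series q = (\<Sum>\<^sub>\<infinity>n. h n)"
    by (simp add: inner)
  have "h summable_on UNIV"
    using summable_on_Sigma_banach[OF summ'] by (simp add: inner)
  hence "h sums G_series q"
    unfolding G by (intro has_sum_imp_sums has_sum_infsum)
  moreover have "h sums (q ^ 3 / (1 - q ^ 3) * P * (P / (1 + q))
      - q ^ 3 / (1 - q ^ 3) * (1 / (1 - q ^ 3)) + q ^ 2 / (1 - q ^ 3) * (1 / (1 - q ^ 5)))"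
    unfolding h_def
  proof (intro sums_add sums_diff sums_mult)
    show "(\<lambda>n. qpoch q (q ^ 2) n / qpoch (q ^ 2) (q ^ 2) n * (q ^ 3) ^ n) sums (P / (1 + q))"
      unfolding P_def by (rule sums_qpoch_cubes[OF q])
  qed (rule geometric_sums; use q in \<open>simp add: norm_power power_less_one_iff\<close>)+
  ultimately have "G_series q = q ^ 3 / (1 - q ^ 3) * P * (P / (1 + q))
      - q ^ 3 / (1 - q ^ 3) * (1 / (1 - q ^ 3)) + q ^ 2 / (1 - q ^ 3) * (1 / (1 - q ^ 5))"
    using sums_unique2 by blast
  also have "\<dots> = q ^ 3 / ((1 + q) * (1 - q ^ 3)) * P ^ 2
      - (q ^ 3 * (1 - q ^ 5) - q ^ 2 * (1 - q ^ 3)) / ((1 - q ^ 3) ^ 2 * (1 - q ^ 5))"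
    using one_minus_power_nonzero[OF q, of 3] one_minus_power_nonzero[OF q, of 5]
    by (simp add: power2_eq_square diff_divide_distrib mult_ac)
  also have "q ^ 3 * (1 - q ^ 5) - q ^ 2 * (1 - q ^ 3)
      = q ^ 2 * (1 - q) * (- 1 + q ^ 3 + q ^ 4 + q ^ 5)"
    by algebra
  finally show ?thesis
    by (simp add: P_def power_divide)
qed

section \<open>The Taylor coefficients at the origin\<close>

definition integer_coeffs :: "complex fps \<Rightarrow> bool" where
  "integer_coeffs F \<longleftrightarrow> (\<forall>n. fps_nth F n \<in> \<int>)"

lemma integer_coeffs_1: "integer_coeffs 1"
  and integer_coeffs_X_power: "integer_coeffs (fps_X ^ m)"
  and integer_coeffs_diff: "integer_coeffs F \<Longrightarrow> integer_coeffs H \<Longrightarrow> integer_coeffs (F - H)"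
  and integer_coeffs_mult: "integer_coeffs F \<Longrightarrow> integer_coeffs H \<Longrightarrow> integer_coeffs (F * H)"
  by (auto simp: integer_coeffs_def fps_X_power_nth fps_mult_nth)

lemma fps_prod_nth_0: "fps_nth (\<Prod>j\<in>A. F j) 0 = (\<Prod>j\<in>A. fps_nth (F j :: 'a :: comm_ring_1 fps) 0)"
  by (induction A rule: infinite_finite_induct) simp_all

lemma integer_coeffs_prod:
  "(\<And>j. j \<in> A \<Longrightarrow> integer_coeffs (F j)) \<Longrightarrow> integer_coeffs (\<Prod>j\<in>A. F j)"
  by (induction A rule: infinite_finite_induct)
     (auto intro: integer_coeffs_1 integer_coeffs_mult)

text \<open>
  The recursion for the coefficients of the inverse divides only by the constant term.
\<close>

lemma integer_coeffs_inverse: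
  assumes "integer_coeffs F" "fps_nth F 0 = 1"
  shows "integer_coeffs (inverse F)"
proof -
  have "natfun_inverse F n \<in> \<int>" for n
  proof (induction n rule: less_induct)
    case (less n)
    show ?case
      using assms less.IH by (cases n) (auto simp: integer_coeffs_def)
  qed
  thus ?thesis by (simp add: integer_coeffs_def fps_inverse_def)
qed

lemma G_term_expansion:
  obtains F where "(\<lambda>q. G_term q k n) has_fps_expansion F" "integer_coeffs F"
proof -
  define D :: "nat \<Rightarrow> complex fps" where
    "D = (\<lambda>m. \<Prod>j<k. 1 - fps_X ^ m * (fps_X ^ 2) ^ j)"
  have D: "(\<lambda>q. qpoch (q ^ m) (q ^ 2) k) has_fps_expansion D m" for m
    unfolding D_def qpoch_def by (intro fps_expansion_intros)
  have intD: "integer_coeffs (D m)" for m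
    unfolding D_def power_mult[symmetric] power_add[symmetric]
    by (intro integer_coeffs_prod integer_coeffs_diff integer_coeffs_1 integer_coeffs_X_power)
  have D0: "fps_nth (D (2 * n + 1)) 0 = 1"
    by (simp add: D_def fps_prod_nth_0)
  show ?thesis
  proof
    show "(\<lambda>q. G_term q k n) has_fps_expansion
            D (2 * n + 2) * inverse (D (2 * n + 1)) * fps_X ^ (2 * k + 5 * n + 2)"
      unfolding G_term_def divide_inverse using D0 by (intro fps_expansion_intros D) simp
    show "integer_coeffs (D (2 * n + 2) * inverse (D (2 * n + 1)) * fps_X ^ (2 * k + 5 * n + 2))"
      by (intro integer_coeffs_mult integer_coeffs_inverse integer_coeffs_X_power intD D0)
  qed
qed

lemma taylor_coeff_partial_sum_Ints:
  "(deriv ^^ N) (\<lambda>q. \<Sum>(k, n)\<in>X. G_term q k n) 0 / fact N \<in> \<int>"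
proof -
  have "\<forall>x. \<exists>F. (\<lambda>q. G_term q (fst x) (snd x)) has_fps_expansion F \<and> integer_coeffs F"
    using G_term_expansion by metis
  then obtain F where F: "\<And>x. (\<lambda>q. G_term q (fst x) (snd x)) has_fps_expansion F x"
      "\<And>x. integer_coeffs (F x)"
    by metis
  have "(\<lambda>q. \<Sum>(k, n)\<in>X. G_term q k n) has_fps_expansion (\<Sum>x\<in>X. F x)"
    unfolding case_prod_unfold by (intro has_fps_expansion_sum F)
  moreover have "fps_nth (\<Sum>x\<in>X. F x) N \<in> \<int>"
    using F(2) by (auto simp: fps_sum_nth integer_coeffs_def)
  ultimately show ?thesis
    by (simp add: fps_nth_fps_expansion)
qed

lemma holomorphic_G_term: "(\<lambda>q. G_term q k n) holomorphic_on ball 0 1"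
  unfolding G_term_def qpoch_def
proof (intro holomorphic_intros)
  fix q :: complex assume "q \<in> ball 0 1"
  hence "norm q < 1" by simp
  hence "qpoch (q ^ (2 * n + 1)) (q ^ 2) k \<noteq> 0"
    by (intro qpoch_nonzero) (simp_all add: norm_power power_less_one_iff del: power_Suc)
  thus "(\<Prod>j<k. 1 - q ^ (2 * n + 1) * (q ^ 2) ^ j) \<noteq> 0"
    by (simp add: qpoch_def)
qed

lemma uniform_limit_G_series:
  assumes "r < 1"
  shows "uniform_limit (cball 0 r) (\<lambda>X q. \<Sum>(k, n)\<in>X. G_term q k n) G_series
           (finite_subsets_at_top UNIV)"
proof (cases "0 \<le> r")
  case True
  have "uniform_limit (cball 0 r) (\<lambda>X q. \<Sum>x\<in>X. case x of (k, n) \<Rightarrow> G_term q k n)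
          (\<lambda>q. \<Sum>\<^sub>\<infinity>x\<in>UNIV. case x of (k, n) \<Rightarrow> G_term q k n) (finite_subsets_at_top UNIV)"
    using norm_G_term_le[OF _ assms]
    by (intro Weierstrass_m_test_general[OF _
          summable_on_geometric_pairs[OF True assms, of "exp (2 / (1 - r) ^ 2)"]]) auto
  thus ?thesis by (simp add: G_series_def[abs_def])
qed (simp add: uniform_limit_iff)

lemma holomorphic_partial_sum_G_term:
  "(\<lambda>q. \<Sum>(k, n)\<in>X. G_term q k n) holomorphic_on ball 0 1"
  unfolding case_prod_unfold by (intro holomorphic_intros holomorphic_G_term)

lemma holomorphic_G_series: "G_series holomorphic_on ball 0 1"
proof -
  have "G_series holomorphic_on ball 0 r" if r: "0 < r" "r < 1" for r
  proof (rule holomorphic_uniform_limit[OF _ uniform_limit_G_series[OF r(2)]])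
    show "\<forall>\<^sub>F X in finite_subsets_at_top UNIV.
        continuous_on (cball 0 r) (\<lambda>q. \<Sum>(k, n)\<in>X. G_term q k n) \<and>
        (\<lambda>q. \<Sum>(k, n)\<in>X. G_term q k n) holomorphic_on ball 0 r"
      using r
      by (intro always_eventually allI conjI holomorphic_on_imp_continuous_on
            holomorphic_on_subset[OF holomorphic_partial_sum_G_term]) auto
  qed auto
  hence "G_series holomorphic_on (\<Union>r\<in>{0<..<1}. ball 0 r)"
    by (intro holomorphic_on_UN_open) auto
  also have "(\<Union>r\<in>{0<..<1}. ball (0::complex) r) = ball 0 1"
  proof (intro equalityI subsetI)
    fix q :: complex assume "q \<in> ball 0 1"
    then obtain r where "norm q < r" "r < 1" using dense by auto
    moreover from this have "0 < r" by (metis norm_ge_zero order_le_less_trans)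
    ultimately show "q \<in> (\<Union>r\<in>{0<..<1}. ball 0 r)" by auto
  qed auto
  finally show ?thesis .
qed

lemma G_eq_deriv: "G N = (deriv ^^ N) G_series 0 / fact N"
  by (simp add: G_def fps_expansion_def)

text \<open>
  By Weierstrass' theorem the Taylor coefficients of the finite partial sums converge to those of
  the limit, and a limit of integers is an integer.
\<close>

lemma G_Ints: "G N \<in> \<int>"
proof -
  have "((\<lambda>X. (deriv ^^ N) (\<lambda>q. \<Sum>(k, n)\<in>X. G_term q k n) 0)
           \<longlongrightarrow> (deriv ^^ N) G_series 0) (finite_subsets_at_top UNIV)"
  proof (rule higher_deriv_complex_uniform_limit)
    show "uniform_limit (ball 0 (1/2)) (\<lambda>X q. \<Sum>(k, n)\<in>X. G_term q k n) G_series
            (finite_subsets_at_top UNIV)"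
      by (rule uniform_limit_on_subset[OF uniform_limit_G_series[of "1/2"]]) auto
    show "\<forall>\<^sub>F X in finite_subsets_at_top UNIV.
            (\<lambda>q. \<Sum>(k, n)\<in>X. G_term q k n) holomorphic_on ball 0 (1/2)"
      by (intro always_eventually allI holomorphic_on_subset[OF holomorphic_partial_sum_G_term]) auto
  qed auto
  hence lim: "((\<lambda>X. (deriv ^^ N) (\<lambda>q. \<Sum>(k, n)\<in>X. G_term q k n) 0 / fact N)
           \<longlongrightarrow> G N) (finite_subsets_at_top UNIV)"
    unfolding G_eq_deriv by (intro tendsto_divide tendsto_const) auto
  show ?thesis
    by (rule Lim_in_closed_set[OF closed_Ints _ _ lim])
       (auto intro!: always_eventually taylor_coeff_partial_sum_Ints)
qed

theorem theorem2p8: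
  "(\<forall>N. G N \<in> \<int>) \<and>
   (\<forall>q::complex. norm q < 1 \<longrightarrow>
      (\<lambda>(k, n). norm (G_term q k n)) summable_on UNIV \<and>
      (\<lambda>N. G N * q ^ N) sums G_series q \<and>
      (\<Sum>N. G N * q ^ N) =
        q ^ 3 / ((1 + q) * (1 - q ^ 3)) * ((qpoch_inf (q ^ 2) (q ^ 2)) ^ 2 / (qpoch_inf q (q ^ 2)) ^ 2)
        - q ^ 2 * (1 - q) * (- 1 + q ^ 3 + q ^ 4 + q ^ 5) / ((1 - q ^ 3) ^ 2 * (1 - q ^ 5)))"
proof (intro conjI allI impI)
  show "G N \<in> \<int>" for N by (rule G_Ints)
  fix q :: complex assume q: "norm q < 1"
  show "(\<lambda>(k, n). norm (G_term q k n)) summable_on UNIV"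
    by (rule G_term_abs_summable[OF q])
  show sums: "(\<lambda>N. G N * q ^ N) sums G_series q"
    using holomorphic_power_series[OF holomorphic_G_series, of q] q by (simp add: G_eq_deriv)
  show "(\<Sum>N. G N * q ^ N) =
        q ^ 3 / ((1 + q) * (1 - q ^ 3)) * ((qpoch_inf (q ^ 2) (q ^ 2)) ^ 2 / (qpoch_inf q (q ^ 2)) ^ 2)
        - q ^ 2 * (1 - q) * (- 1 + q ^ 3 + q ^ 4 + q ^ 5) / ((1 - q ^ 3) ^ 2 * (1 - q ^ 5))"
    using sums_unique[OF sums] G_series_closed_form[OF q] by simp
qed

end
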